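(* Let $d\geqslant2$, let $(S,\mathscr{S},\rho)$ be a $\sigma$-finite measure space and let $A:(S,\mathscr{S})\to\mathbb{M}_d$ be a measurable function such that $$\rho(\{s\in S:A(s)\neq0\})<\infty,\qquad\int_S\|A(s)\|^2\rho(\mathrm{d}s)<\infty,$$ and $$\rho(\{s\in S:\det(A(s))\neq0\})>0.$$ Moreover, let $\Gamma$ be a Lévy measure on $\mathbb{R}^d$ such that $\boldsymbol{0}\in\operatorname{int}\operatorname{conv}\operatorname{supp}\Gamma_\varepsilon$ for any $\varepsilon>0$. Then the Upsilon transformation $\Lambda=\Upsilon^0_A[\Gamma]$, $$\Upsilon^0_A[\Gamma](B)=\int_S\int_{\mathbb{R}^d}\mathbf{1}_{B\setminus\{\boldsymbol{0}\}}(A(s)\boldsymbol{x})\,\Gamma(\mathrm{d}\boldsymbol{x})\,\rho(\mathrm{d}s),\quad B\subset\mathbb{R}^d\text{ Borel},$$ defines a Lévy measure on $\mathbb{R}^d$ satisfying $\boldsymbol{0}\in\operatorname{int}\operatorname{conv}\operatorname{supp}\Lambda_\varepsilon$ for any $\varepsilon>0$.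
   Context: $\mathbb{M}_d$ is the space of real $d\times d$ matrices and $\|\cdot\|$ the Frobenius norm. A Lévy measure on $\mathbb{R}^d$ is a Borel measure $\Lambda$ with $\Lambda(\{\boldsymbol{0}\})=0$ and $\int\min\{1,\|\boldsymbol{x}\|^2\}\Lambda(\mathrm{d}\boldsymbol{x})<\infty$. For a Lévy measure $\Lambda$ (likewise $\Gamma$), $\Lambda_\varepsilon(A)=\Lambda\big(A\cap B(\boldsymbol{0},\varepsilon)\big)$ for Borel $A\subset\mathbb{R}^d$, where $B(\boldsymbol{0},\varepsilon)$ is the open ball of radius $\varepsilon$ centred at the origin. $\operatorname{supp}$ is the closed support of a measure, $\operatorname{conv}$ the convex hull, $\operatorname{int}$ the interior in $\mathbb{R}^d$. *)

theory Defs
  imports "HOL-Analysis.Analysis"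
begin

text \<open>The norm of \<^typ>\<open>real^'n^'n\<close> is the Euclidean norm of the vector of the Euclidean norms
  of the rows, i.e. the Frobenius norm.\<close>

lemma norm_matrix_frobenius:
  fixes M :: "real^'n^'m"
  shows "norm M = sqrt (\<Sum>i\<in>UNIV. \<Sum>j\<in>UNIV. (M $ i $ j)\<^sup>2)"
  by (simp add: norm_vec_def L2_set_def sum_nonneg)

definition levy_measure :: "(real^'n) measure \<Rightarrow> bool" where
  "levy_measure L \<longleftrightarrow> sets L = sets borel \<and> emeasure L {0} = 0 \<and>
     (\<integral>\<^sup>+ x. ennreal (min 1 ((norm x)\<^sup>2)) \<partial>L) < \<infinity>"

definition truncated_measure :: "(real^'n) measure \<Rightarrow> real \<Rightarrow> (real^'n) measure" where
  "truncated_measure L \<epsilon> = density L (indicator (ball 0 \<epsilon>))"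

lemma emeasure_truncated_measure:
  assumes "sets L = sets borel" "B \<in> sets borel"
  shows "emeasure (truncated_measure L \<epsilon>) B = emeasure L (B \<inter> ball 0 \<epsilon>)"
  using assms
  by (simp add: truncated_measure_def emeasure_restricted Int_commute)

definition measure_support :: "'a::topological_space measure \<Rightarrow> 'a set" where
  "measure_support M = {x. \<forall>U. open U \<longrightarrow> x \<in> U \<longrightarrow> emeasure M U > 0}"

definition Upsilon0_fun ::
  "'s measure \<Rightarrow> ('s \<Rightarrow> real^'n^'n) \<Rightarrow> (real^'n) measure \<Rightarrow> (real^'n) set \<Rightarrow> ennreal" where
  "Upsilon0_fun \<rho> A \<Gamma> B =
     (\<integral>\<^sup>+ s. (\<integral>\<^sup>+ x. indicator (B - {0}) (A s *v x) \<partial>\<Gamma>) \<partial>\<rho>)"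

text \<open>\<^const>\<open>measure_of\<close> yields the null measure when the given set function is not a measure,
  so \<^term>\<open>emeasure (Upsilon0 \<rho> A \<Gamma>) B = Upsilon0_fun \<rho> A \<Gamma> B\<close> is not automatic.\<close>

definition Upsilon0 ::
  "'s measure \<Rightarrow> ('s \<Rightarrow> real^'n^'n) \<Rightarrow> (real^'n) measure \<Rightarrow> (real^'n) measure" where
  "Upsilon0 \<rho> A \<Gamma> = measure_of UNIV (sets borel) (Upsilon0_fun \<rho> A \<Gamma>)"

end

theory Submission imports Defs begin

text \<open>Since the null set of points outside the support of the law of \<^term>\<open>A\<close> cannot exhaust
  \<^term>\<open>{s. det (A s) \<noteq> 0}\<close>, some invertible matrix \<^term>\<open>M\<close> lies in that support.  Every small
  neighbourhood of \<^term>\<open>(M, x)\<close>, with \<^term>\<open>x\<close> in the support of \<^term>\<open>\<Gamma>\<close>, is charged by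
  the product measure, so \<^term>\<open>M *v x\<close> lies in the support of the transformed measure.  Hence the
  image under the linear homeomorphism \<^term>\<open>M\<close> of the support of a sufficiently truncated
  \<^term>\<open>\<Gamma>\<close> is contained in the support of the truncated transform, and the interior of its convex
  hull contains the origin.\<close>

section \<open>Norm bound and continuity of the matrix action\<close>

lemma norm_matrix_vector_mult_le:
  fixes M :: "real^'n^'m" and x :: "real^'n"
  shows "norm (M *v x) \<le> norm M * norm x"
proof -
  \<comment> \<open>Each component of \<open>M *v x\<close> is the inner product of a row of
    \<open>M\<close> with \<open>x\<close>, so Cauchy-Schwarz applies row by row.\<close>
  have "norm (M *v x) \<le> L2_set (\<lambda>i. norm (M $ i) * norm x) UNIV"
    unfolding norm_vec_def[of "M *v x"]
    by (intro L2_set_mono) (auto simp: matrix_vector_mul_component Cauchy_Schwarz_ineq2)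
  also have "\<dots> = norm M * norm x"
    by (simp add: norm_vec_def[of M] L2_set_left_distrib)
  finally show ?thesis .
qed

text \<open>Supplies joint continuity in the matrix and the vector, used for measurability of the
  action and for open preimages under it.\<close>

lemma bounded_bilinear_matrix_vector_mult:
  "bounded_bilinear ((*v) :: real^'n^'m \<Rightarrow> real^'n \<Rightarrow> real^'m)"
proof
  show "\<exists>K. \<forall>(M :: real^'n^'m) x. norm (M *v x) \<le> norm M * norm x * K"
    by (rule exI[of _ 1]) (simp add: norm_matrix_vector_mult_le)
qed (simp_all add: vec_eq_iff matrix_vector_mul_component inner_add_left inner_add_right)

lemma continuous_on_det: "continuous_on S (det :: real^'n^'n \<Rightarrow> real)"
  unfolding det_def by (intro continuous_intros)

section \<open>Sigma-finiteness of Levy measures\<close>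

lemma sigma_finite_measure_if_nn_integral_finite:
  fixes f :: "'a \<Rightarrow> ennreal"
  assumes [measurable]: "f \<in> borel_measurable M"
    and int: "(\<integral>\<^sup>+ x. f x \<partial>M) < \<infinity>" and zero: "emeasure M {x \<in> space M. f x = 0} < \<infinity>"
  shows "sigma_finite_measure M"
proof
  \<comment> \<open>For \<open>n > 0\<close> this is the superlevel set of \<open>f\<close> at
    height \<open>1/n\<close>, of finite measure by Markov's inequality; \<open>C 0\<close> is
    empty. Together with the zero set of \<open>f\<close> these sets exhaust the space.\<close>
  define C where "C n = {x \<in> space M. 1 \<le> of_nat n * f x}" for n :: nat
  have "emeasure M (C n) \<noteq> \<infinity>" for n
  proof -
    have "emeasure M (C n) \<le> of_nat n * (\<integral>\<^sup>+ x. f x * indicator (space M) x \<partial>M)"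
      unfolding C_def by (intro nn_integral_Markov_inequality) auto
    also have "\<dots> = of_nat n * (\<integral>\<^sup>+ x. f x \<partial>M)"
      by (auto intro!: arg_cong[where f = "\<lambda>c. of_nat n * c"] nn_integral_cong)
    also have "\<dots> < \<infinity>"
      using int by (simp add: ennreal_mult_less_top of_nat_less_top)
    finally show ?thesis by simp
  qed
  moreover have "C n \<in> sets M" for n
    unfolding C_def by measurable
  moreover have "(\<Union>n. C n) \<union> {x \<in> space M. f x = 0} = space M"
  proof -
    have "\<exists>n. 1 \<le> of_nat n * f x" if "f x \<noteq> 0" for x
    proof (cases "f x = \<infinity>")
      case True
      then show ?thesis by (intro exI[of _ 1]) simp
    next
      case False
      then have r: "f x = ennreal (enn2real (f x))" "0 < enn2real (f x)"
        using that by (auto simp: enn2real_positive_iff less_top zero_less_iff_neq_zero)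
      define r where "r = enn2real (f x)"
      note r = r[folded r_def]
      obtain n where "1 / r < real n"
        using reals_Archimedean2 by blast
      then have "1 \<le> real n * r"
        using r by (simp add: field_simps)
      then have "1 \<le> of_nat n * f x"
        using r by (simp add: ennreal_of_nat_eq_real_of_nat flip: ennreal_mult ennreal_1)
      then show ?thesis by blast
    qed
    then show ?thesis by (auto simp: C_def)
  qed
  ultimately show "\<exists>A. countable A \<and> A \<subseteq> sets M \<and> \<Union>A = space M \<and> (\<forall>a\<in>A. emeasure M a \<noteq> \<infinity>)"
    using zero by (intro exI[of _ "insert {x \<in> space M. f x = 0} (range C)"]) auto
qed

text \<open>The integrand \<open>min 1 ((norm x)\<^sup>2)\<close> vanishes only at the origin, which
  carries no mass. Sigma-finiteness gives access to the product with \<rho> and to Tonelli's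
  theorem.\<close>

lemma levy_measure_sigma_finite:
  assumes "levy_measure L"
  shows "sigma_finite_measure L"
proof (rule sigma_finite_measure_if_nn_integral_finite)
  have sets: "sets L = sets borel" and space: "space L = UNIV"
    using assms sets_eq_imp_space_eq[of L borel] by (auto simp: levy_measure_def)
  show "(\<lambda>x. ennreal (min 1 ((norm x)\<^sup>2))) \<in> borel_measurable L"
    unfolding measurable_cong_sets[OF sets refl] by measurable
  show "(\<integral>\<^sup>+ x. ennreal (min 1 ((norm x)\<^sup>2)) \<partial>L) < \<infinity>"
    using assms by (simp add: levy_measure_def)
  have "{x \<in> space L. ennreal (min 1 ((norm x)\<^sup>2)) = 0} = {0}"
    using space by (auto simp: ennreal_eq_0_iff min_def split: if_splits)
  then show "emeasure L {x \<in> space L. ennreal (min 1 ((norm x)\<^sup>2)) = 0} < \<infinity>"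
    using assms by (simp add: levy_measure_def)
qed

section \<open>Supports of Borel measures\<close>

lemma AE_in_measure_support:
  fixes M :: "'a::second_countable_topology measure"
  assumes sets: "sets M = sets borel"
  shows "AE x in M. x \<in> measure_support M"
proof -
  \<comment> \<open>The complement of the support is the union of all open null sets; by the
    Lindelof property countably many of them suffice, so it is null.\<close>
  define F where "F = {U. open U \<and> emeasure M U = 0}"
  obtain F' where F': "F' \<subseteq> F" "countable F'" "\<Union>F' = \<Union>F"
    using Lindelof[of F] by (auto simp: F_def)
  have "\<Union>F' \<in> null_sets M"
    using F' by (intro null_sets_UN'[of F' "\<lambda>U. U", simplified])
      (auto simp: F_def null_sets_def sets)
  moreover have "{x \<in> space M. x \<notin> measure_support M} \<subseteq> \<Union>F'"
    unfolding F'(3) by (auto simp: F_def measure_support_def zero_less_iff_neq_zero)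
  ultimately show ?thesis
    by (rule AE_I')
qed

text \<open>The closed ball appears because the support of a measure carried by an open ball can
  reach the boundary sphere.\<close>

lemma measure_support_truncated_subset:
  assumes sets: "sets L = sets borel"
  shows "measure_support (truncated_measure L \<epsilon>) \<subseteq> measure_support L \<inter> cball 0 \<epsilon>"
proof
  fix x assume x: "x \<in> measure_support (truncated_measure L \<epsilon>)"
  have pos: "emeasure L (U \<inter> ball 0 \<epsilon>) > 0" if "open U" "x \<in> U" for U
    using x that emeasure_truncated_measure[OF sets, of U \<epsilon>]
    by (auto simp: measure_support_def)
  have "emeasure L U > 0" if "open U" "x \<in> U" for U
    using pos[OF that] emeasure_mono[of "U \<inter> ball 0 \<epsilon>" U L] that sets
    by (auto intro: less_le_trans)
  moreover have "norm x \<le> \<epsilon>"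
  proof (rule ccontr)
    assume "\<not> norm x \<le> \<epsilon>"
    then have "emeasure L ((- cball 0 \<epsilon>) \<inter> ball 0 \<epsilon>) > 0"
      by (intro pos) auto
    moreover have "(- cball 0 \<epsilon>) \<inter> ball 0 \<epsilon> = {}"
      by auto
    ultimately show False by (metis emeasure_empty less_irrefl)
  qed
  ultimately show "x \<in> measure_support L \<inter> cball 0 \<epsilon>"
    by (auto simp: measure_support_def)
qed

section \<open>The transform as a measure, its Levy property and its support\<close>

context
  fixes \<rho> :: "'s measure" and A :: "'s \<Rightarrow> real^'n^'n" and \<Gamma> :: "(real^'n) measure"
  assumes A: "A \<in> borel_measurable \<rho>" and \<Gamma>: "levy_measure \<Gamma>"
begin

lemma sets_levy: "sets \<Gamma> = sets borel"
  using \<Gamma> by (simp add: levy_measure_def)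

interpretation sigma_finite_measure \<Gamma>
  using \<Gamma> by (rule levy_measure_sigma_finite)

lemma measurable_matrix_action [measurable]:
  "(\<lambda>p. A (fst p) *v snd p) \<in> borel_measurable (\<rho> \<Otimes>\<^sub>M \<Gamma>)"
proof (rule borel_measurable_continuous_Pair[where g = snd and H = "(*v)"])
  show "(\<lambda>p. A (fst p)) \<in> borel_measurable (\<rho> \<Otimes>\<^sub>M \<Gamma>)"
    using A by measurable
  show "snd \<in> borel_measurable (\<rho> \<Otimes>\<^sub>M \<Gamma>)"
    using measurable_snd[of \<rho> \<Gamma>]
    unfolding measurable_cong_sets[OF refl sets_levy, of "\<rho> \<Otimes>\<^sub>M \<Gamma>"] .
  show "continuous_on UNIV (\<lambda>p. (fst p :: real^'n^'n) *v snd p)"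
    by (intro bounded_bilinear.continuous_on[OF bounded_bilinear_matrix_vector_mult]
        continuous_intros)
qed

text \<open>Realises the transform as the image of the product measure under the action, restricted
  to the complement of the origin. Countable additivity is thereby inherited from a known
  measure.\<close>

lemma Upsilon0_eq_density_distr:
  "Upsilon0 \<rho> A \<Gamma> =
     density (distr (\<rho> \<Otimes>\<^sub>M \<Gamma>) borel (\<lambda>p. A (fst p) *v snd p)) (indicator (- {0}))"
  (is "_ = ?N")
proof -
  have "Upsilon0_fun \<rho> A \<Gamma> B = emeasure ?N B" if [measurable]: "B \<in> sets borel" for B
  proof -
    have "Upsilon0_fun \<rho> A \<Gamma> B
        = (\<integral>\<^sup>+ p. indicator (B - {0}) (A (fst p) *v snd p) \<partial>(\<rho> \<Otimes>\<^sub>M \<Gamma>))"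
      unfolding Upsilon0_fun_def by (subst nn_integral_fst[symmetric]) auto
    also have "\<dots> = (\<integral>\<^sup>+ y. indicator (B - {0}) y
        \<partial>distr (\<rho> \<Otimes>\<^sub>M \<Gamma>) borel (\<lambda>p. A (fst p) *v snd p))"
      by (subst nn_integral_distr) auto
    also have "\<dots> = emeasure ?N B"
      by (subst emeasure_restricted) (auto simp: Diff_eq Int_commute)
    finally show ?thesis .
  qed
  \<comment> \<open>\<open>measure_of\<close> depends only on the values of the set function on the
    generated sigma-algebra, so agreement on Borel sets is enough.\<close>
  then have "Upsilon0 \<rho> A \<Gamma> = measure_of UNIV (sets borel) (emeasure ?N)"
    unfolding Upsilon0_def
    by (intro measure_of_eq) (auto simp: sets.sigma_sets_eq[of borel, simplified])
  also have "\<dots> = ?N"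
    using measure_of_of_measure[of ?N] by simp
  finally show ?thesis .
qed

lemma sets_Upsilon0 [simp]: "sets (Upsilon0 \<rho> A \<Gamma>) = sets borel"
  by (simp add: Upsilon0_eq_density_distr)

text \<open>Change of variables followed by Tonelli. Indicators as \<open>f\<close> give the values
  of the measure; the truncated square of the norm gives the Levy property.\<close>

lemma nn_integral_Upsilon0:
  assumes [measurable]: "f \<in> borel_measurable borel"
  shows "(\<integral>\<^sup>+ y. f y \<partial>Upsilon0 \<rho> A \<Gamma>)
    = (\<integral>\<^sup>+ s. \<integral>\<^sup>+ x. indicator (- {0}) (A s *v x) * f (A s *v x) \<partial>\<Gamma> \<partial>\<rho>)"
proof -
  have "(\<integral>\<^sup>+ y. f y \<partial>Upsilon0 \<rho> A \<Gamma>) = (\<integral>\<^sup>+ p. indicator (- {0}) (A (fst p) *v snd p)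
      * f (A (fst p) *v snd p) \<partial>(\<rho> \<Otimes>\<^sub>M \<Gamma>))"
    unfolding Upsilon0_eq_density_distr
    by (subst nn_integral_density; (subst nn_integral_distr)?) auto
  then show ?thesis
    by (subst (asm) nn_integral_fst[symmetric]) auto
qed

lemma emeasure_Upsilon0:
  assumes "B \<in> sets borel"
  shows "emeasure (Upsilon0 \<rho> A \<Gamma>) B = Upsilon0_fun \<rho> A \<Gamma> B"
proof -
  have "emeasure (Upsilon0 \<rho> A \<Gamma>) B = (\<integral>\<^sup>+ y. indicator B y \<partial>Upsilon0 \<rho> A \<Gamma>)"
    using assms by simp
  also have "\<dots> = Upsilon0_fun \<rho> A \<Gamma> B"
    using assms unfolding Upsilon0_fun_def
    by (subst nn_integral_Upsilon0) (auto intro!: nn_integral_cong simp: indicator_def)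
  finally show ?thesis .
qed

lemma levy_measure_Upsilon0:
  assumes fin: "emeasure \<rho> {s \<in> space \<rho>. A s \<noteq> 0} < \<infinity>"
    and int: "(\<integral>\<^sup>+ s. ennreal ((norm (A s))\<^sup>2) \<partial>\<rho>) < \<infinity>"
  shows "levy_measure (Upsilon0 \<rho> A \<Gamma>)"
proof -
  note A [measurable]
  define c where "c = (\<integral>\<^sup>+ x. ennreal (min 1 ((norm x)\<^sup>2)) \<partial>\<Gamma>)"
  \<comment> \<open>The factor \<open>1 + (norm (A s))\<^sup>2\<close> dominates in both regimes:
    the square handles \<open>norm x \<le> 1\<close>, the 1 handles the cap otherwise. Where
    \<open>A s = 0\<close> the left side of \<open>bound\<close> vanishes, so the 1 can be cut down
    to an indicator with finite integral.\<close>
  let ?h = "\<lambda>s. indicator {s \<in> space \<rho>. A s \<noteq> 0} s + ennreal ((norm (A s))\<^sup>2)"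
  have [measurable]: "(\<lambda>x. ennreal (min 1 ((norm x)\<^sup>2))) \<in> borel_measurable \<Gamma>"
    unfolding measurable_cong_sets[OF sets_levy refl] by measurable
  have bound: "ennreal (min 1 ((norm (A s *v x))\<^sup>2)) \<le> ?h s * ennreal (min 1 ((norm x)\<^sup>2))"
    if "s \<in> space \<rho>" for s x
  proof (cases "A s = 0")
    case False
    let ?a = "(norm (A s))\<^sup>2" and ?b = "(norm x)\<^sup>2"
    have le: "(norm (A s *v x))\<^sup>2 \<le> ?a * ?b"
      using power_mono[OF norm_matrix_vector_mult_le, of "A s" x 2] by (simp add: power_mult_distrib)
    have "min 1 ((norm (A s *v x))\<^sup>2) \<le> (1 + ?a) * min 1 ?b"
    proof (cases "?b \<le> 1")
      case True
      have "min 1 ((norm (A s *v x))\<^sup>2) \<le> ?a * ?b"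
        using le by simp
      also have "\<dots> \<le> (1 + ?a) * ?b"
        by (intro mult_right_mono) auto
      finally show ?thesis
        using True by (simp add: min_absorb2)
    next
      case False
      then show ?thesis by (simp add: min_le_iff_disj min_absorb1)
    qed
    then have "ennreal (min 1 ((norm (A s *v x))\<^sup>2)) \<le> ennreal (1 + ?a) * ennreal (min 1 ?b)"
      by (subst ennreal_mult[symmetric]) (auto intro: ennreal_leI)
    then show ?thesis
      using False that by simp
  qed simp
  have "(\<integral>\<^sup>+ y. ennreal (min 1 ((norm y)\<^sup>2)) \<partial>Upsilon0 \<rho> A \<Gamma>)
      \<le> (\<integral>\<^sup>+ s. \<integral>\<^sup>+ x. ?h s * ennreal (min 1 ((norm x)\<^sup>2)) \<partial>\<Gamma> \<partial>\<rho>)"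
    using bound
    by (subst nn_integral_Upsilon0) (auto intro!: nn_integral_mono simp: indicator_def)
  also have "\<dots> = (\<integral>\<^sup>+ s. ?h s * c \<partial>\<rho>)"
    unfolding c_def by (intro nn_integral_cong nn_integral_cmult) measurable
  also have "\<dots> = (emeasure \<rho> {s \<in> space \<rho>. A s \<noteq> 0} + (\<integral>\<^sup>+ s. ennreal ((norm (A s))\<^sup>2) \<partial>\<rho>)) * c"
    by (simp add: nn_integral_multc nn_integral_add)
  also have "\<dots> < \<infinity>"
    using fin int \<Gamma> by (simp add: c_def levy_measure_def ennreal_mult_less_top)
  \<comment> \<open>The origin gets no mass because the transform integrates the indicator of
    \<open>B - {0}\<close>.\<close>
  finally show ?thesis
    by (simp add: levy_measure_def emeasure_Upsilon0 Upsilon0_fun_def)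
qed

lemma matrix_vector_mult_in_support_Upsilon0:
  assumes det: "det M \<noteq> 0" and M: "M \<in> measure_support (distr \<rho> borel A)"
    and x: "x \<in> measure_support \<Gamma>" and norm: "norm (M *v x) < \<epsilon>"
  shows "M *v x \<in> measure_support (truncated_measure (Upsilon0 \<rho> A \<Gamma>) \<epsilon>)"
  unfolding measure_support_def
proof (intro CollectI allI impI)
  fix U :: "(real^'n) set" assume U: "open U" "M *v x \<in> U"
  note A [measurable]
  have "open ((\<lambda>p :: (real^'n^'n) \<times> (real^'n). fst p *v snd p) -` (U \<inter> ball 0 \<epsilon>))"
    using U by (intro open_vimage
        bounded_bilinear.continuous_on[OF bounded_bilinear_matrix_vector_mult] continuous_intros) auto
  moreover have "(M, x) \<in> (\<lambda>p. fst p *v snd p) -` (U \<inter> ball 0 \<epsilon>)"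
    using U norm by simp
  ultimately obtain V W where VW: "open V" "open W" "M \<in> V" "x \<in> W"
    "V \<times> W \<subseteq> (\<lambda>p. fst p *v snd p) -` (U \<inter> ball 0 \<epsilon>)"
    by (elim open_prod_elim) auto
  \<comment> \<open>Shrinking to invertible matrices keeps nonzero vectors away from the origin,
    whose mass the transform discards.\<close>
  define V' where "V' = V \<inter> {N. det N \<noteq> 0}"
  have "open V'"
    using VW(1) open_vimage[OF _ continuous_on_det, of "- {0}"]
    by (auto simp: V'_def vimage_def intro!: open_Int)
  then have [measurable]: "V' \<in> sets borel" by simp
  have "0 < emeasure (distr \<rho> borel A) V'"
    using M \<open>open V'\<close> VW(3) det by (auto simp: measure_support_def V'_def)
  then have pos1: "0 < emeasure \<rho> (A -` V' \<inter> space \<rho>)"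
    by (simp add: emeasure_distr)
  have "0 < emeasure \<Gamma> W"
    using x VW by (auto simp: measure_support_def)
  also have "\<dots> = emeasure \<Gamma> (W - {0})"
    using \<Gamma> VW(2) by (intro emeasure_Diff_null_set[symmetric])
      (auto simp: levy_measure_def null_sets_def)
  finally have pos2: "0 < emeasure \<Gamma> (W - {0})" .
  have sets_W: "W - {0} \<in> sets \<Gamma>"
    using VW(2) by (auto simp: sets_levy)
  \<comment> \<open>The rectangle of matrices in \<open>V'\<close> and vectors in
    \<open>W - {0}\<close> has positive product mass, and the action sends it into the target set
    without the origin.\<close>
  have "0 < emeasure \<Gamma> (W - {0}) * emeasure \<rho> (A -` V' \<inter> space \<rho>)"
    using pos1 pos2 by (simp add: ennreal_zero_less_mult_iff)
  also have "\<dots> = (\<integral>\<^sup>+ s. \<integral>\<^sup>+ x. indicator (W - {0}) x * indicator (A -` V' \<inter> space \<rho>) s \<partial>\<Gamma> \<partial>\<rho>)"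
    using sets_W by (simp add: nn_integral_multc nn_integral_cmult)
  also have "\<dots> \<le> Upsilon0_fun \<rho> A \<Gamma> (U \<inter> ball 0 \<epsilon>)"
    unfolding Upsilon0_fun_def
  proof (intro nn_integral_mono)
    fix s y
    show "indicator (W - {0}) y * indicator (A -` V' \<inter> space \<rho>) s
        \<le> (indicator (U \<inter> ball 0 \<epsilon> - {0}) (A s *v y) :: ennreal)"
    proof (cases "y \<in> W - {0} \<and> A s \<in> V'")
      case True
      then have "A s *v y \<noteq> 0"
        using matrix_left_invertible_ker[of "A s"] invertible_det_nz[of "A s"]
          invertible_left_inverse[of "A s"] by (auto simp: V'_def)
      moreover have "A s *v y \<in> U \<inter> ball 0 \<epsilon>"
        using True VW(5) by (force simp: V'_def)
      ultimately show ?thesis by (auto simp: indicator_def)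
    qed (auto simp: indicator_def)
  qed
  also have "\<dots> = emeasure (truncated_measure (Upsilon0 \<rho> A \<Gamma>) \<epsilon>) U"
    using U by (simp add: emeasure_truncated_measure emeasure_Upsilon0)
  finally show "0 < emeasure (truncated_measure (Upsilon0 \<rho> A \<Gamma>) \<epsilon>) U" .
qed

end

theorem proposition3p24:
  fixes \<rho> :: "'s measure"
    and A :: "'s \<Rightarrow> real^'n^'n"
    and \<Gamma> :: "(real^'n) measure"
  assumes "CARD('n) \<ge> 2"
    and "sigma_finite_measure \<rho>"
    and "A \<in> borel_measurable \<rho>"
    and "emeasure \<rho> {s \<in> space \<rho>. A s \<noteq> 0} < \<infinity>"
    and "(\<integral>\<^sup>+ s. ennreal ((norm (A s))\<^sup>2) \<partial>\<rho>) < \<infinity>"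
    and "emeasure \<rho> {s \<in> space \<rho>. det (A s) \<noteq> 0} > 0"
    and "levy_measure \<Gamma>"
    and "\<And>\<epsilon>. \<epsilon> > 0 \<Longrightarrow>
           0 \<in> interior (convex hull (measure_support (truncated_measure \<Gamma> \<epsilon>)))"
  shows "(\<forall>B\<in>sets borel. emeasure (Upsilon0 \<rho> A \<Gamma>) B = Upsilon0_fun \<rho> A \<Gamma> B) \<and>
         levy_measure (Upsilon0 \<rho> A \<Gamma>) \<and>
         (\<forall>\<epsilon>>0. 0 \<in> interior (convex hull
                   (measure_support (truncated_measure (Upsilon0 \<rho> A \<Gamma>) \<epsilon>))))"
proof (intro conjI ballI allI impI)
  note A = assms(3) and \<Gamma> = assms(7)
  show "emeasure (Upsilon0 \<rho> A \<Gamma>) B = Upsilon0_fun \<rho> A \<Gamma> B" if "B \<in> sets borel" for B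
    using A \<Gamma> that by (rule emeasure_Upsilon0)
  show "levy_measure (Upsilon0 \<rho> A \<Gamma>)"
    using A \<Gamma> assms(4,5) by (rule levy_measure_Upsilon0)
  fix \<epsilon> :: real assume "\<epsilon> > 0"
  \<comment> \<open>Were every matrix in the support singular, \<open>A s\<close> would be singular
    almost everywhere, since \<open>A s\<close> almost surely lies in the support of its
    law.\<close>
  obtain M where M: "det M \<noteq> 0" "M \<in> measure_support (distr \<rho> borel A)"
  proof (rule ccontr)
    assume "\<not> thesis"
    then have "\<And>N. N \<in> measure_support (distr \<rho> borel A) \<Longrightarrow> det N = 0"
      using that by blast
    moreover have "AE s in \<rho>. A s \<in> measure_support (distr \<rho> borel A)"
      using AE_distrD[OF A AE_in_measure_support] by simp
    ultimately have "AE s in \<rho>. \<not> det (A s) \<noteq> 0"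
      by auto
    moreover have "{s \<in> space \<rho>. det (A s) \<noteq> 0} \<in> sets \<rho>"
      using measurable_compose[OF A borel_measurable_continuous_onI[OF continuous_on_det]]
      by measurable
    ultimately have "emeasure \<rho> {s \<in> space \<rho>. det (A s) \<noteq> 0} = 0"
      by (subst (asm) AE_iff_measurable[OF _ refl]) auto
    then show False
      using assms(6) by simp
  qed
  have inj: "inj ((*v) M)"
    using M(1) invertible_det_nz inj_matrix_vector_mult by blast
  \<comment> \<open>Chosen so that \<open>norm x \<le> \<delta>\<close> forces
    \<open>norm (M *v x) < \<epsilon>\<close>. The added 1 makes this strict, as needed because the
    truncated support is only known to lie in the closed ball.\<close>
  define \<delta> where "\<delta> = \<epsilon> / (norm M + 1)"
  have \<delta>: "\<delta> > 0"
    using \<open>\<epsilon> > 0\<close> by (simp add: \<delta>_def add_nonneg_pos)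
  let ?S = "measure_support (truncated_measure \<Gamma> \<delta>)"
    and ?T = "measure_support (truncated_measure (Upsilon0 \<rho> A \<Gamma>) \<epsilon>)"
  have "(*v) M ` ?S \<subseteq> ?T"
  proof (intro image_subsetI)
    fix x assume "x \<in> ?S"
    then have x: "x \<in> measure_support \<Gamma>" "norm x \<le> \<delta>"
      using measure_support_truncated_subset[OF sets_levy[OF A \<Gamma>], of \<delta>] by auto
    have "norm (M *v x) \<le> norm M * \<delta>"
      using norm_matrix_vector_mult_le[of M x] mult_left_mono[OF x(2), of "norm M"] by simp
    also have "\<dots> < (norm M + 1) * \<delta>"
      using \<delta> by (simp add: algebra_simps)
    also have "\<dots> = \<epsilon>"
      using add_nonneg_pos[of "norm M" 1] by (simp add: \<delta>_def)
    finally show "M *v x \<in> ?T"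
      using A \<Gamma> M x(1) by (intro matrix_vector_mult_in_support_Upsilon0)
  qed
  then have "interior (convex hull ((*v) M ` ?S)) \<subseteq> interior (convex hull ?T)"
    by (intro interior_mono hull_mono)
  \<comment> \<open>Convex hulls commute with linear maps, and interiors with injective linear maps
    of a Euclidean space to itself.\<close>
  moreover have "interior (convex hull ((*v) M ` ?S)) = (*v) M ` interior (convex hull ?S)"
    using inj by (simp add: interior_injective_linear_image flip: convex_hull_linear_image)
  moreover have "0 \<in> (*v) M ` interior (convex hull ?S)"
    using assms(8)[OF \<delta>] by (intro image_eqI[of _ _ 0]) auto
  ultimately show "0 \<in> interior (convex hull ?T)"
    by blast
qed

end
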